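(* Let $\pi\in\Pi$, $\delta\in(0,1]$ and $\lambda>0$. Let $$U^\lambda_{\mathrm{IX}}(\pi)=\frac1n\sum_{i=1}^n\frac{\pi(a_i|x_i)}{\pi_0(a_i|x_i)+\lambda/2}\,c_i+\frac{\ln(1/\delta)}{\lambda n}$$ and $$U^\lambda_\infty(\pi)=\psi_\lambda\Big(-\frac1n\sum_{i=1}^n\frac1\lambda\log\big(1-\lambda w_\pi(x_i,a_i)c_i\big)+\frac{\ln(1/\delta)}{\lambda n}\Big).$$ Then for any $\lambda>0$, $$U^\lambda_\infty(\pi)\le U^\lambda_{\mathrm{IX}}(\pi).$$
   Context: Setting (offline contextual bandit). $\mathcal{X}\subset\mathbb{R}^d$ is a compact context space, $\mathcal{A}=\{1,\dots,K\}$ a finite action set. A policy $\pi$ assigns to each $x\in\mathcal{X}$ a probability distribution $\pi(\cdot|x)$ on $\mathcal{A}$; $\Pi$ is the set of policies and $\pi_0$ is a fixed behavior policy. The logged data is $(x_i,a_i,c_i)_{i\in[n]}$ with $x_i\in\mathcal{X}$, $a_i\in\mathcal{A}$ drawn from $\pi_0(\cdot|x_i)$ (so $\pi_0(a_i|x_i)>0$), and costs $c_i\in[-1,0]$. The inequality holds for any realization of the data. Notation: $w_\pi(x,a)=\pi(a|x)/\pi_0(a|x)$ and $\psi_\lambda(x)=\frac1\lambda(1-e^{-\lambda x})$ for $x\in\mathbb{R}$. *)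

theory Defs
  imports "HOL-Probability.Probability"
begin

text \<open>
  A policy maps every context \<open>x \<in> X\<close> to a probability distribution on the action set \<open>{1..K}\<close>;
  \<open>\<pi>(a|x)\<close> is written \<open>pmf (\<pi> x) a\<close>. Values of a policy outside \<open>X\<close> are irrelevant.
\<close>

definition policies :: "(real ^ 'd) set \<Rightarrow> nat \<Rightarrow> (real ^ 'd \<Rightarrow> nat pmf) set" where
  "policies X K = {\<pi>. \<forall>x\<in>X. set_pmf (\<pi> x) \<subseteq> {1..K}}"

definition importance_weight ::
  "(real ^ 'd \<Rightarrow> nat pmf) \<Rightarrow> (real ^ 'd \<Rightarrow> nat pmf) \<Rightarrow> real ^ 'd \<Rightarrow> nat \<Rightarrow> real" where
  "importance_weight \<pi>0 \<pi> x a = pmf (\<pi> x) a / pmf (\<pi>0 x) a"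

definition psi :: "real \<Rightarrow> real \<Rightarrow> real" where
  "psi l x = 1 / l * (1 - exp (- l * x))"

text \<open>
  The logged data \<open>(x i, a i, c i)\<close> are indexed by \<open>i \<in> {1..n}\<close>; the parameter \<open>l\<close> is the
  \<open>\<lambda>\<close> of the mathematical notation.
\<close>

definition U_IX ::
  "(real ^ 'd \<Rightarrow> nat pmf) \<Rightarrow> nat \<Rightarrow> (nat \<Rightarrow> real ^ 'd) \<Rightarrow> (nat \<Rightarrow> nat) \<Rightarrow> (nat \<Rightarrow> real)
    \<Rightarrow> real \<Rightarrow> real \<Rightarrow> (real ^ 'd \<Rightarrow> nat pmf) \<Rightarrow> real" where
  "U_IX \<pi>0 n x a c \<delta> l \<pi> =
     1 / real n * (\<Sum>i = 1..n. pmf (\<pi> (x i)) (a i) / (pmf (\<pi>0 (x i)) (a i) + l / 2) * c i)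
     + ln (1 / \<delta>) / (l * real n)"

definition U_inf ::
  "(real ^ 'd \<Rightarrow> nat pmf) \<Rightarrow> nat \<Rightarrow> (nat \<Rightarrow> real ^ 'd) \<Rightarrow> (nat \<Rightarrow> nat) \<Rightarrow> (nat \<Rightarrow> real)
    \<Rightarrow> real \<Rightarrow> real \<Rightarrow> (real ^ 'd \<Rightarrow> nat pmf) \<Rightarrow> real" where
  "U_inf \<pi>0 n x a c \<delta> l \<pi> =
     psi l (- (1 / real n) *
              (\<Sum>i = 1..n. 1 / l * ln (1 - l * importance_weight \<pi>0 \<pi> (x i) (a i) * c i))
            + ln (1 / \<delta>) / (l * real n))"

end

theory Submission
  imports Defs
begin

text \<open>
  Since \<open>psi l y \<le> y\<close>, it suffices to compare the two sums term by term. With \<open>p = \<pi>(a|x)\<close>,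
  \<open>q = \<pi>\<^sub>0(a|x)\<close> and \<open>t = - l * (p / q) * c \<ge> 0\<close>, the inequality \<open>ln (1 + t) \<ge> t / (1 + t / 2)\<close>
  gives \<open>ln (1 + t) \<ge> - l * p * c / (q + l * (- p * c) / 2)\<close>, and \<open>- p * c \<le> 1\<close> turns the
  denominator into \<open>q + l / 2\<close>.
\<close>

text \<open>The left side is the first term of \<open>ln x = 2 * (y + y^3 / 3 + ...)\<close> with
  \<open>y = (x - 1) / (x + 1)\<close> at \<open>x = 1 + t\<close>; the later terms are
  nonnegative.\<close>

lemma ln_one_plus_ge_pade:
  fixes t :: real
  assumes "t \<ge> 0"
  shows "2 * t / (2 + t) \<le> ln (1 + t)"
proof (cases "t = 0")
  case False
  then show ?thesis
    using assms ln_approx_bounds[of "1 + t" 1] by simp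
qed simp

lemma psi_le_self:
  assumes "l > 0"
  shows "psi l y \<le> y"
proof -
  have "1 - exp (- l * y) \<le> l * y"
    using exp_ge_add_one_self[of "- l * y"] by simp
  then show ?thesis
    using assms by (simp add: psi_def field_simps)
qed

lemma log_estimate_le_ix_term:
  fixes p q c l :: real
  assumes "0 \<le> p" "p \<le> 1" "q > 0" "c \<in> {-1..0}" "l > 0"
  shows "- (1 / l * ln (1 - l * (p / q) * c)) \<le> p / (q + l / 2) * c"
proof -
  \<comment> \<open>Both sides depend on \<open>p\<close> and \<open>c\<close> only through this
    product, which lies in \<open>[0, 1]\<close>.\<close>
  define u where "u = - (p * c)"
  have u: "0 \<le> u" "u \<le> 1"
    using assms mult_mono[of p 1 "- c" 1] by (auto simp: u_def mult_nonneg_nonpos)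
  have "l * u / (q + l / 2) \<le> l * u / (q + l * u / 2)"
    using assms u by (intro divide_left_mono mult_pos_pos add_pos_nonneg) auto
  \<comment> \<open>Scaling numerator and denominator by \<open>2 / q\<close> exposes the bound at
    \<open>t = l * u / q\<close>.\<close>
  also have "\<dots> = 2 * (l * u / q) / (2 + l * u / q)"
    using assms u by (simp add: field_simps)
  also have "\<dots> \<le> ln (1 + l * u / q)"
    using assms u by (intro ln_one_plus_ge_pade) auto
  finally have "u / (q + l / 2) \<le> 1 / l * ln (1 + l * u / q)"
    using assms by (simp add: pos_le_divide_eq mult.commute)
  then show ?thesis
    by (simp add: u_def mult.assoc)
qed

theorem proposition8:
  fixes X :: "(real ^ 'd) set" and K n :: nat
    and \<pi>0 \<pi> :: "real ^ 'd \<Rightarrow> nat pmf"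
    and x :: "nat \<Rightarrow> real ^ 'd" and a :: "nat \<Rightarrow> nat" and c :: "nat \<Rightarrow> real"
    and \<delta> l :: real
  assumes "compact X"
    and "\<pi>0 \<in> policies X K"
    and "n \<ge> 1"
    and "\<And>i. i \<in> {1..n} \<Longrightarrow> x i \<in> X"
    and "\<And>i. i \<in> {1..n} \<Longrightarrow> a i \<in> {1..K}"
    and "\<And>i. i \<in> {1..n} \<Longrightarrow> pmf (\<pi>0 (x i)) (a i) > 0"
    and "\<And>i. i \<in> {1..n} \<Longrightarrow> c i \<in> {-1..0}"
    and "\<pi> \<in> policies X K"
    and "\<delta> \<in> {0<..1}"
    and "l > 0"
  shows "U_inf \<pi>0 n x a c \<delta> l \<pi> \<le> U_IX \<pi>0 n x a c \<delta> l \<pi>"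
proof -
  let ?L = "\<Sum>i = 1..n. 1 / l * ln (1 - l * importance_weight \<pi>0 \<pi> (x i) (a i) * c i)"
  let ?S = "\<Sum>i = 1..n. pmf (\<pi> (x i)) (a i) / (pmf (\<pi>0 (x i)) (a i) + l / 2) * c i"
  have "- ?L \<le> ?S"
    unfolding importance_weight_def sum_negf[symmetric]
    using assms(6,7,10)
    by (intro sum_mono log_estimate_le_ix_term) (auto simp: pmf_le_1)
  then have "1 / real n * - ?L \<le> 1 / real n * ?S"
    by (rule mult_left_mono) simp
  then have "- (1 / real n) * ?L + ln (1 / \<delta>) / (l * real n) \<le> U_IX \<pi>0 n x a c \<delta> l \<pi>"
    unfolding U_IX_def by simp
  \<comment> \<open>The argument of \<open>psi l\<close> includes the confidence term, so removing
    \<open>psi l\<close> leaves that term exactly as it stands in \<open>U_IX\<close>.\<close>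
  moreover have "U_inf \<pi>0 n x a c \<delta> l \<pi> \<le> - (1 / real n) * ?L + ln (1 / \<delta>) / (l * real n)"
    unfolding U_inf_def by (rule psi_le_self[OF assms(10)])
  ultimately show ?thesis by (rule order_trans[rotated])
qed

end
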